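(* Let $R$ be a commutative ring with unity such that $\bigcap_{i=1}^{\infty}\mathcal{M}^i=(0)$ for every maximal ideal $\mathcal{M}$ of $R$. Let $\mathcal{I}\subseteq R$ be an ideal and let $\mathcal{J}_1,\dots,\mathcal{J}_r$ be proper ideals of $R$ (i.e. $\mathcal{J}_i\neq R$) such that $\mathcal{I}=\bigcup_{i=1}^r\mathcal{I}\mathcal{J}_i$. Then $\mathcal{I}=(0)$. *)

theory Defs
  imports "HOL-Algebra.Ideal_Product"
begin

end

theory Submission
  imports Defs
begin

text \<open>
  Enlarge each \<open>J\<^sub>i\<close> to a maximal ideal \<open>M\<^sub>i\<close>. If \<open>I \<noteq> I M\<^sub>i\<close> for all \<open>i\<close>, then by the Chinese
  remainder theorem \<open>I\<close> maps onto the product of the nonzero quotients \<open>I / I M\<close> over the distinct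
  \<open>M\<close> among the \<open>M\<^sub>i\<close>, so some element of \<open>I\<close> lies in no \<open>I M\<^sub>i\<close>, against the hypothesis. Hence
  \<open>I = I M\<close> for some maximal ideal \<open>M\<close>, and then \<open>I = I M\<^sup>k \<subseteq> M\<^sup>k\<close> for every \<open>k\<close>.
\<close>

text \<open>Supplies the upper bounds for Zorn's lemma. Closure under addition holds because two
  elements of the union already lie in a common member of the chain.\<close>

lemma (in ring) ideal_Union_chain:
  assumes "C \<noteq> {}" and "subset.chain {K. ideal K R} C"
  shows "ideal (\<Union>C) R"
proof (rule idealI[OF ring_axioms])
  have ide: "ideal K R" if "K \<in> C" for K
    using assms(2) that by (auto simp: subset_chain_def)
  show "subgroup (\<Union>C) (add_monoid R)"
  proof (rule add.subgroupI)
    show "\<Union>C \<subseteq> carrier R"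
      using ide ideal.Icarr by fastforce
    show "\<Union>C \<noteq> {}"
      using assms(1) ide additive_subgroup.zero_closed[OF ideal.axioms(1)] by fastforce
    show "\<ominus> a \<in> \<Union>C" if "a \<in> \<Union>C" for a
      using that ide additive_subgroup.a_inv_closed[OF ideal.axioms(1)] by fastforce
    fix a b assume "a \<in> \<Union>C" "b \<in> \<Union>C"
    then obtain A B where "A \<in> C" "B \<in> C" "a \<in> A" "b \<in> B" by blast
    then obtain K where K: "K \<in> C" "a \<in> K" "b \<in> K"
      using assms(2) unfolding subset_chain_def by blast
    then show "a \<oplus> b \<in> \<Union>C"
      using additive_subgroup.a_closed[OF ideal.axioms(1)[OF ide]] by blast
  qed
  show "x \<otimes> a \<in> \<Union>C" if "a \<in> \<Union>C" "x \<in> carrier R" for a x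
    using that ide ideal.I_l_closed by fastforce
  show "a \<otimes> x \<in> \<Union>C" if "a \<in> \<Union>C" "x \<in> carrier R" for a x
    using that ide ideal.I_r_closed by fastforce
qed

lemma (in ring) exists_maximalideal_superset:
  assumes "ideal J R" and "J \<noteq> carrier R"
  obtains M where "maximalideal M R" and "J \<subseteq> M"
proof -
  \<comment> \<open>Properness is encoded as \<open>\<one> \<notin> K\<close>, a condition that
    visibly passes to unions of chains.\<close>
  let ?P = "{K. ideal K R \<and> J \<subseteq> K \<and> \<one> \<notin> K}"
  have "\<exists>M\<in>?P. \<forall>K\<in>?P. M \<subseteq> K \<longrightarrow> K = M"
  proof (rule subset_Zorn_nonempty)
    show "?P \<noteq> {}"
      using assms ideal.one_imp_carrier by fastforce
    fix C assume C: "C \<noteq> {}" "subset.chain ?P C"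
    then have "ideal (\<Union>C) R"
      by (intro ideal_Union_chain) (auto simp: subset_chain_def)
    then show "\<Union>C \<in> ?P"
      using C by (auto simp: subset_chain_def)
  qed
  then obtain M where "M \<in> ?P" and maxP: "\<forall>K\<in>?P. M \<subseteq> K \<longrightarrow> K = M" ..
  then have M: "ideal M R" "J \<subseteq> M" "\<one> \<notin> M"
    by simp_all
  have max: "K = M" if "ideal K R" "J \<subseteq> K" "\<one> \<notin> K" "M \<subseteq> K" for K
    using maxP that by simp
  have "maximalideal M R"
  proof (rule maximalidealI[OF M(1)])
    show "carrier R \<noteq> M"
      using M(3) by auto
    show "K = M \<or> K = carrier R" if "ideal K R" "M \<subseteq> K" for K
      using max[OF that(1) order.trans[OF M(2) that(2)] _ that(2)]
        ideal.one_imp_carrier[OF that(1)] by blast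
  qed
  then show thesis
    using M(2) that by blast
qed

lemma (in ring) ideal_prod_mono:
  assumes "A \<subseteq> A'" and "B \<subseteq> B'"
  shows "A \<cdot> B \<subseteq> A' \<cdot> B'"
proof
  fix x assume "x \<in> A \<cdot> B"
  then show "x \<in> A' \<cdot> B'"
    using assms by induct (auto intro: ideal_prod.intros)
qed

lemma (in cring) subset_ideal_power:
  assumes "ideal I R" and "I = I \<cdot> M"
  shows "I \<subseteq> M [^]\<^bsub>ideals_set R\<^esub> (k::nat)"
proof (induct k)
  case 0
  \<comment> \<open>The zeroth power is the unit of the monoid of ideals, that is, the whole
    carrier.\<close>
  show ?case
    using assms(1) by (auto simp: nat_pow_def ideals_set_def ideal.Icarr)
next
  case (Suc k)
  have "I \<subseteq> (M [^]\<^bsub>ideals_set R\<^esub> k) \<cdot> M"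
    using ideal_prod_mono[OF Suc, of M M] assms(2) by simp
  then show ?case
    by (simp add: nat_pow_def ideals_set_def)
qed

text \<open>The Chinese remainder ingredient: each \<open>N\<close> in \<open>S\<close> contains an
  element outside \<open>M\<close>. The product of these elements lies in every \<open>N\<close>,
  but not in \<open>M\<close>, since \<open>M\<close> is prime.\<close>

lemma (in cring) maximalideal_avoid:
  assumes "finite S" and "\<And>N. N \<in> S \<Longrightarrow> maximalideal N R"
    and M: "maximalideal M R" and "M \<notin> S"
  obtains e where "e \<in> carrier R" and "\<And>N. N \<in> S \<Longrightarrow> e \<in> N" and "e \<notin> M"
proof -
  have "\<exists>e\<in>carrier R. (\<forall>N\<in>S. e \<in> N) \<and> e \<notin> M"
    using assms(1,2,4)
  proof (induct S)
    case empty
    show ?case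
      using M maximalideal.I_notcarr maximalideal.axioms(1) ideal.one_imp_carrier by fastforce
  next
    case (insert N S)
    then obtain e where e: "e \<in> carrier R" "\<forall>N\<in>S. e \<in> N" "e \<notin> M"
      by auto
    have N: "maximalideal N R" "N \<noteq> M"
      using insert.prems by auto
    have idN: "ideal N R"
      by (rule maximalideal.axioms(1)[OF N(1)])
    have idM: "ideal M R"
      by (rule maximalideal.axioms(1)[OF M])
    \<comment> \<open>By maximality of \<open>N\<close>, an inclusion in the proper ideal
      \<open>M\<close> would force \<open>N = M\<close>.\<close>
    have "\<not> N \<subseteq> M"
      using maximalideal.I_maximal[OF N(1) idM] maximalideal.I_notcarr[OF M] N(2)
        ideal.Icarr[OF idM] by blast
    then obtain n where n: "n \<in> N" "n \<notin> M" by blast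
    have nc: "n \<in> carrier R"
      using n(1) idN ideal.Icarr by fastforce
    have "e \<otimes> n \<notin> M"
      using primeideal.I_prime[OF maximalideal_prime[OF M] e(1) nc] e(3) n(2) by blast
    moreover have "e \<otimes> n \<in> N"
      using ideal.I_l_closed[OF idN n(1) e(1)] .
    moreover have "e \<otimes> n \<in> K" if "K \<in> S" for K
      using that e(2) nc insert.prems(1) maximalideal.axioms(1) ideal.I_r_closed by fastforce
    ultimately show ?case
      using e(1) nc by auto
  qed
  then show thesis
    using that by blast
qed

text \<open>An element outside \<open>M\<close> is invertible modulo \<open>M\<close>: the ideal
  \<open>M <+> PIdl e\<close> strictly contains \<open>M\<close>, hence is everything and contains
  \<open>\<one>\<close>.\<close>

lemma (in cring) maximalideal_inverse_mod:
  assumes M: "maximalideal M R" and e: "e \<in> carrier R" "e \<notin> M"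
  obtains a m where "a \<in> carrier R" and "m \<in> M" and "m \<oplus> a \<otimes> e = \<one>"
proof -
  interpret M: maximalideal M R by fact
  have idP: "ideal (PIdl e) R"
    by (rule cgenideal_ideal[OF e(1)])
  have id: "ideal (M <+> PIdl e) R"
    by (rule add_ideals[OF M.is_ideal idP])
  have "M \<union> PIdl e \<subseteq> M <+> PIdl e"
    using union_genideal[OF M.is_ideal idP] genideal_self[of "M \<union> PIdl e"]
      M.a_subset ideal.Icarr[OF idP] by blast
  then have "M \<subseteq> M <+> PIdl e" and "e \<in> M <+> PIdl e"
    using cgenideal_self[OF e(1)] by auto
  moreover have "M <+> PIdl e \<subseteq> carrier R"
    by (rule subsetI) (rule ideal.Icarr[OF id])
  ultimately have "M <+> PIdl e = carrier R"
    using M.I_maximal[OF id] e(2) by auto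
  then have "\<one> \<in> M <+> PIdl e" by simp
  then show thesis
    using that by (auto simp: set_add_def' cgenideal_def)
qed

text \<open>Induction on \<open>S\<close> replaces an explicit Chinese remainder isomorphism. If the
  \<open>x\<close> found for \<open>S\<close> falls into \<open>I \<cdot> M\<close>, it is corrected
  by \<open>y \<otimes> e\<close>, which vanishes modulo every \<open>I \<cdot> N\<close> with
  \<open>N\<close> in \<open>S\<close> but not modulo \<open>I \<cdot> M\<close>.\<close>

lemma (in cring) exists_notin_ideal_prods:
  assumes I: "ideal I R" and "finite S"
    and "\<And>M. M \<in> S \<Longrightarrow> maximalideal M R" and "\<And>M. M \<in> S \<Longrightarrow> I \<noteq> I \<cdot> M"
  obtains x where "x \<in> I" and "\<And>M. M \<in> S \<Longrightarrow> x \<notin> I \<cdot> M"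
proof -
  interpret I: ideal I R by fact
  have "\<exists>x\<in>I. \<forall>M\<in>S. x \<notin> I \<cdot> M"
    using assms(2-4)
  proof (induct S)
    case empty
    show ?case
      using I.zero_closed by blast
  next
    case (insert M S)
    then obtain x where x: "x \<in> I" "\<forall>N\<in>S. x \<notin> I \<cdot> N"
      by auto
    show ?case
    proof (cases "x \<in> I \<cdot> M")
      case False
      then show ?thesis
        using x by auto
    next
      case xM: True
      have M: "maximalideal M R"
        using insert.prems by auto
      have idM: "ideal M R"
        by (rule maximalideal.axioms(1)[OF M])
      have idS: "ideal N R" if "N \<in> S" for N
        using insert.prems(1) that maximalideal.axioms(1) by blast
      have "\<not> I \<subseteq> I \<cdot> M"
        using insert.prems(2)[of M] ideal_prod_inter[OF I idM] by auto
      then obtain y where y: "y \<in> I" "y \<notin> I \<cdot> M" by blast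
      obtain e where e: "e \<in> carrier R" "\<And>N. N \<in> S \<Longrightarrow> e \<in> N" "e \<notin> M"
        using maximalideal_avoid[OF insert.hyps(1) _ M insert.hyps(2)] insert.prems(1) by blast
      obtain a m where am: "a \<in> carrier R" "m \<in> M" "m \<oplus> a \<otimes> e = \<one>"
        using maximalideal_inverse_mod[OF M e(1,3)] .
      have carr: "x \<in> carrier R" "y \<in> carrier R" "m \<in> carrier R"
        using x(1) y(1) am(2) ideal.Icarr[OF idM] I.Icarr by auto
      have ye: "y \<otimes> e \<in> carrier R"
        using carr e(1) by simp
      have cancel: "x \<in> K" if "ideal K R" "x \<oplus> y \<otimes> e \<in> K" "y \<otimes> e \<in> K" for K
      proof -
        interpret K: ideal K R by fact
        have "(x \<oplus> y \<otimes> e) \<ominus> y \<otimes> e \<in> K"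
          unfolding a_minus_def by (intro K.a_closed K.a_inv_closed that)
        then show ?thesis
          using carr(1) ye by (simp add: a_minus_def a_assoc r_neg)
      qed
      have cancel': "y \<otimes> e \<in> K" if "ideal K R" "x \<oplus> y \<otimes> e \<in> K" "x \<in> K" for K
      proof -
        interpret K: ideal K R by fact
        have "\<ominus> x \<oplus> (x \<oplus> y \<otimes> e) \<in> K"
          by (intro K.a_closed K.a_inv_closed that)
        then show ?thesis
          using carr(1) ye by (simp add: r_neg1)
      qed
      \<comment> \<open>Here \<open>y \<otimes> e\<close> is in \<open>I \<cdot> N\<close> because
        \<open>e\<close> is in \<open>N\<close>, so membership of the sum would put \<open>x\<close>
        itself in \<open>I \<cdot> N\<close>.\<close>
      have "x \<oplus> y \<otimes> e \<notin> I \<cdot> N" if "N \<in> S" for N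
        using cancel[OF ideal_prod_is_ideal[OF I idS[OF that]]] x(2) that
          ideal_prod.prod[OF y(1) e(2)[OF that], of R] by blast
      moreover have "x \<oplus> y \<otimes> e \<notin> I \<cdot> M"
      proof
        assume A: "x \<oplus> y \<otimes> e \<in> I \<cdot> M"
        have idIM: "ideal (I \<cdot> M) R"
          by (rule ideal_prod_is_ideal[OF I idM])
        have "y \<otimes> e \<otimes> a \<in> I \<cdot> M"
          using ideal.I_r_closed[OF idIM cancel'[OF idIM A xM] am(1)] .
        \<comment> \<open>Multiplying \<open>m \<oplus> a \<otimes> e = \<one>\<close> by
          \<open>y\<close> writes \<open>y\<close> as a sum of two elements of
          \<open>I \<cdot> M\<close>, against the choice of \<open>y\<close>.\<close>
        then have "y \<otimes> m \<oplus> y \<otimes> e \<otimes> a \<in> I \<cdot> M"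
          by (intro ideal_prod.sum ideal_prod.prod[OF y(1) am(2)])
        also have "y \<otimes> m \<oplus> y \<otimes> e \<otimes> a = y \<otimes> (m \<oplus> a \<otimes> e)"
          using carr e(1) am(1) by (simp add: r_distr m_ac)
        also have "\<dots> = y"
          using carr(2) am(3) by simp
        finally show False
          using y(2) by simp
      qed
      moreover have "x \<oplus> y \<otimes> e \<in> I"
        by (intro I.a_closed I.I_r_closed x(1) y(1) e(1))
      ultimately show ?thesis
        by blast
    qed
  qed
  then show thesis
    using that by blast
qed

theorem mainTheorem4:
  fixes R :: "('a, 'b) ring_scheme" (structure)
    and I :: "'a set" and J :: "nat \<Rightarrow> 'a set" and r :: nat
  assumes "cring R"
    and "\<And>M. maximalideal M R \<Longrightarrow>
           (\<Inter>i\<in>{1::nat..}. M [^]\<^bsub>ideals_set R\<^esub> i) = {\<zero>\<^bsub>R\<^esub>}"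
    and "ideal I R"
    and "\<And>i. i \<in> {1..r} \<Longrightarrow> ideal (J i) R"
    and "\<And>i. i \<in> {1..r} \<Longrightarrow> J i \<noteq> carrier R"
    and "I = (\<Union>i\<in>{1..r}. I \<cdot>\<^bsub>R\<^esub> J i)"
  shows "I = {\<zero>\<^bsub>R\<^esub>}"
proof -
  interpret cring R by fact
  interpret I: ideal I R by fact
  have "\<exists>M. maximalideal M R \<and> J i \<subseteq> M" if "i \<in> {1..r}" for i
    using exists_maximalideal_superset assms(4,5) that by metis
  then obtain F where F: "\<And>i. i \<in> {1..r} \<Longrightarrow> maximalideal (F i) R \<and> J i \<subseteq> F i"
    by metis
  \<comment> \<open>Passing to the image set merges equal \<open>F i\<close>, so that the maximal
    ideals treated in the induction are pairwise distinct.\<close>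
  let ?S = "F ` {1..r}"
  have S: "maximalideal M R" if "M \<in> ?S" for M
    using F that by auto
  have "\<exists>M\<in>?S. I = I \<cdot> M"
  \<comment> \<open>The case \<open>r = 0\<close> is included: \<open>?S\<close> is then empty, and
    an element of \<open>I\<close> would have to lie in an empty union.\<close>
  proof (rule ccontr)
    assume "\<not> ?thesis"
    then have ne: "I \<noteq> I \<cdot> M" if "M \<in> ?S" for M
      using that by metis
    obtain x where x: "x \<in> I" "\<And>M. M \<in> ?S \<Longrightarrow> x \<notin> I \<cdot> M"
      using exists_notin_ideal_prods[OF assms(3), of ?S] S ne
      by (metis finite_atLeastAtMost finite_imageI)
    have "x \<in> (\<Union>i\<in>{1..r}. I \<cdot> J i)"
      using x(1) assms(6) by (rule back_subst)
    then obtain i where i: "i \<in> {1..r}" "x \<in> I \<cdot> J i" ..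
    have "I \<cdot> J i \<subseteq> I \<cdot> F i"
      using F[OF i(1)] by (intro ideal_prod_mono) auto
    then show False
      using x(2)[of "F i"] i by blast
  qed
  then obtain M where M: "M \<in> ?S" "I = I \<cdot> M" ..
  then have "I \<subseteq> (\<Inter>i\<in>{1::nat..}. M [^]\<^bsub>ideals_set R\<^esub> i)"
    by (intro INT_greatest subset_ideal_power[OF assms(3)])
  then have "I \<subseteq> {\<zero>}"
    using assms(2)[OF S[OF M(1)]] by simp
  then show ?thesis
    using I.zero_closed by blast
qed

end
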